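(* For every $\epsilon>0$ there is an explicit construction (a generalized Johnson graph) yielding, for infinitely many $n$, a graph $G$ on $n$ vertices such that (1) $\vartheta(G)/\alpha(G)=\Omega(n^{1-\epsilon})$; (2) $\vartheta(G)/c(G)=\Omega(n^{1-\epsilon})$; (3) $\chi(G)/\vartheta(G^c)=\Omega(n^{1-\epsilon})$, where the implied constants do not depend on $n$.
   Context: For a graph $G$ on $N$ vertices, the Lovász number is $\vartheta(G)=\max\sum_{i,j}b_{ij}$ over all $N\times N$ positive semidefinite matrices $B=(b_{ij})$ with trace $1$ and $b_{ij}=0$ whenever $ij$ is an edge. $\alpha(G)$ is the independence number, $\chi(G)$ the chromatic number, $G^c$ the complement of $G$. The Shannon capacity is $c(G)=\lim_{m\to\infty}\alpha(G^{\boxtimes m})^{1/m}$, where $\boxtimes$ is the strong product: $(u_1,v_1)\sim(u_2,v_2)$ in $G\boxtimes H$ iff ($u_1=u_2$ and $v_1\sim v_2$) or ($u_1\sim u_2$ and $v_1=v_2$) or ($u_1\sim u_2$ and $v_1\sim v_2$). A generalized Johnson graph $G(n,k,L)$, for $L\subset\{0,\ldots,k-1\}$, has vertex set the $k$-subsets of $\{1,\ldots,n\}$, with $A,B$ adjacent iff $|A\cap B|\notin L$. *)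

theory Defs
  imports Complex_Main
begin

(* A finite simple graph is given by a vertex set V and a symmetric irreflexive
   adjacency relation E (only its restriction to V matters). *)

definition independent :: "'a set \<Rightarrow> ('a \<Rightarrow> 'a \<Rightarrow> bool) \<Rightarrow> 'a set \<Rightarrow> bool" where
  "independent V E S \<longleftrightarrow> S \<subseteq> V \<and> (\<forall>x\<in>S. \<forall>y\<in>S. \<not> E x y)"

definition alpha :: "'a set \<Rightarrow> ('a \<Rightarrow> 'a \<Rightarrow> bool) \<Rightarrow> nat" where
  "alpha V E = Max {card S | S. independent V E S}"

definition chi :: "'a set \<Rightarrow> ('a \<Rightarrow> 'a \<Rightarrow> bool) \<Rightarrow> nat" where
  "chi V E = (LEAST k. \<exists>f :: 'a \<Rightarrow> nat. (\<forall>x\<in>V. f x < k) \<and>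
                         (\<forall>x\<in>V. \<forall>y\<in>V. E x y \<longrightarrow> f x \<noteq> f y))"

definition compl_graph :: "'a set \<Rightarrow> ('a \<Rightarrow> 'a \<Rightarrow> bool) \<Rightarrow> 'a \<Rightarrow> 'a \<Rightarrow> bool" where
  "compl_graph V E x y \<longleftrightarrow> x \<in> V \<and> y \<in> V \<and> x \<noteq> y \<and> \<not> E x y"

definition psd_on :: "'a set \<Rightarrow> ('a \<Rightarrow> 'a \<Rightarrow> real) \<Rightarrow> bool" where
  "psd_on V B \<longleftrightarrow> (\<forall>i\<in>V. \<forall>j\<in>V. B i j = B j i) \<and>
     (\<forall>x :: 'a \<Rightarrow> real. (\<Sum>i\<in>V. \<Sum>j\<in>V. x i * B i j * x j) \<ge> 0)"

definition lovasz_theta :: "'a set \<Rightarrow> ('a \<Rightarrow> 'a \<Rightarrow> bool) \<Rightarrow> real" where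
  "lovasz_theta V E = Sup {(\<Sum>i\<in>V. \<Sum>j\<in>V. B i j) | B.
       psd_on V B \<and> (\<Sum>i\<in>V. B i i) = 1 \<and> (\<forall>i\<in>V. \<forall>j\<in>V. E i j \<longrightarrow> B i j = 0)}"

definition strong_pow_vertices :: "'a set \<Rightarrow> nat \<Rightarrow> 'a list set" where
  "strong_pow_vertices V m = {xs. length xs = m \<and> set xs \<subseteq> V}"

definition strong_pow_adj :: "('a \<Rightarrow> 'a \<Rightarrow> bool) \<Rightarrow> 'a list \<Rightarrow> 'a list \<Rightarrow> bool" where
  "strong_pow_adj E xs ys \<longleftrightarrow> xs \<noteq> ys \<and> length xs = length ys \<and>
      (\<forall>i<length xs. xs ! i = ys ! i \<or> E (xs ! i) (ys ! i))"

definition shannon_capacity :: "'a set \<Rightarrow> ('a \<Rightarrow> 'a \<Rightarrow> bool) \<Rightarrow> real" where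
  "shannon_capacity V E =
     lim (\<lambda>m. real (alpha (strong_pow_vertices V m) (strong_pow_adj E)) powr (1 / real m))"

definition johnson_vertices :: "nat \<Rightarrow> nat \<Rightarrow> nat set set" where
  "johnson_vertices n k = {A. A \<subseteq> {1..n} \<and> card A = k}"

definition johnson_adj :: "nat set \<Rightarrow> nat set \<Rightarrow> nat set \<Rightarrow> bool" where
  "johnson_adj L A B \<longleftrightarrow> A \<noteq> B \<and> card (A \<inter> B) \<notin> L"

end

theory Submission
  imports Defs "HOL-Library.FuncSet" "HOL-Number_Theory.Cong"
begin

text \<open>
  For a prime \<open>p\<close> take \<open>k = p^2 - 1\<close> and let \<open>L\<close> consist of the \<open>x < k\<close> with \<open>x \<noteq> -1\<close> modulo \<open>p\<close>, so
  that only \<open>p - 1\<close> intersection sizes are missing from \<open>L\<close>.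

  The matrix with entries \<open>(|A \<inter> B| choose p - 1)\<close> is the Gram matrix of integer vectors of dimension
  \<open>n choose p - 1\<close>, and modulo \<open>p\<close> an entry vanishes unless \<open>|A \<inter> B| = -1\<close>. Tensor powers of these
  vectors are therefore independent modulo \<open>p\<close> on an independent set of a strong power, so that
  both \<open>\<alpha>\<close> and the Shannon capacity are at most \<open>n choose p - 1\<close>.

  For the Lovasz number, start from the all-ones matrix \<open>J\<close>, seen as the polynomial \<open>f = 1\<close> in
  \<open>|A \<inter> B|\<close>, and make \<open>f\<close> vanish at the sizes \<open>z \<notin> L\<close> in increasing order: add a multiple of
  \<open>(|A \<inter> B| choose z)\<close> to kill \<open>f z\<close>, and compensate a possible loss of positivity by adding
  \<open>O(n)\<close> times that multiple of \<open>(|A \<inter> B| choose z + 1)\<close>. After \<open>p - 1\<close> steps the matrix still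
  dominates \<open>J\<close> and its diagonal is \<open>O(n^(p - 1))\<close>, which bounds \<open>\<vartheta>\<close> of the graph from below
  and \<open>\<vartheta>\<close> of its complement from above. All three ratios are thus at least a constant times
  \<open>N / n^(2 * (p - 1))\<close> for \<open>N = (n choose k)\<close> vertices, that is \<open>N\<close> to the power \<open>1 - 2 / (p + 1)\<close>.
\<close>

subsection \<open>Bounding the Lovasz number by a dominating matrix\<close>

lemma finite_johnson [simp]: "finite (johnson_vertices n k)"
  by (simp add: johnson_vertices_def)

lemma card_johnson [simp]: "card (johnson_vertices n k) = n choose k"
  using n_subsets[of "{1..n}" k] by (simp add: johnson_vertices_def)

lemma psd_onD: "psd_on V B \<Longrightarrow> 0 \<le> (\<Sum>i\<in>V. \<Sum>j\<in>V. x i * B i j * x j)"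
  by (simp add: psd_on_def)

text \<open>Evaluate the form at the difference of the unit vectors of \<open>i\<close> and
  \<open>j\<close>.\<close>

lemma psd_on_offdiag:
  assumes "finite V" "psd_on V B" "i \<in> V" "j \<in> V"
  shows "2 * B i j \<le> B i i + B j j"
proof -
  define x :: "'a \<Rightarrow> real" where "x = (\<lambda>k. (if k = i then 1 else 0) - (if k = j then 1 else 0))"
  have s: "(\<Sum>b\<in>V. g b * x b) = g i - g j" for g :: "'a \<Rightarrow> real"
    using assms(1,3,4)
    by (simp add: x_def right_diff_distrib sum_subtractf if_distrib[of "\<lambda>c. g _ * c"] cong: if_cong)
  have s': "(\<Sum>b\<in>V. x b * g b) = g i - g j" for g :: "'a \<Rightarrow> real"
    using s[of g] by (simp add: mult.commute)
  have "0 \<le> (\<Sum>a\<in>V. \<Sum>b\<in>V. x a * B a b * x b)"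
    using assms(2) by (simp add: psd_on_def)
  also have "\<dots> = (B i i - B i j) - (B j i - B j j)"
    unfolding s by (simp only: right_diff_distrib[symmetric] s')
  finally show ?thesis
    using assms by (auto simp: psd_on_def)
qed

text \<open>Sum the previous bound over all pairs. This serves twice: it bounds the set whose
  supremum is the Lovasz number, and it is the form in which Cauchy-Schwarz is applied
  later.\<close>

lemma psd_on_sum_le:
  assumes "finite V" "psd_on V B"
  shows "(\<Sum>i\<in>V. \<Sum>j\<in>V. B i j) \<le> real (card V) * (\<Sum>i\<in>V. B i i)"
proof -
  have "(\<Sum>i\<in>V. \<Sum>j\<in>V. B i j) \<le> (\<Sum>i\<in>V. \<Sum>j\<in>V. (B i i + B j j) / 2)"
    by (intro sum_mono) (use psd_on_offdiag[OF assms] in \<open>simp add: field_simps\<close>)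
  also have "\<dots> = real (card V) * (\<Sum>i\<in>V. B i i)"
    by (simp add: add_divide_distrib sum.distrib flip: sum_divide_distrib sum_distrib_left)
  finally show ?thesis .
qed

lemma psd_on_rank_one: "psd_on V (\<lambda>i j. x i * x j :: real)"
proof -
  have "(\<Sum>i\<in>V. \<Sum>j\<in>V. y i * (x i * x j) * y j) = (\<Sum>i\<in>V. x i * y i)\<^sup>2" for y
    by (simp add: power2_eq_square sum_product mult_ac)
  then show ?thesis
    by (simp add: psd_on_def mult.commute)
qed

text \<open>The new matrix is \<open>U B U^T\<close>, where \<open>U\<close> has the rows
  \<open>u s\<close>; its form at \<open>x\<close> is that of \<open>B\<close> at
  \<open>U^T x\<close>.\<close>

lemma psd_on_congruence:
  fixes u :: "'b \<Rightarrow> 'a \<Rightarrow> real"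
  assumes "psd_on V B"
  shows "psd_on I (\<lambda>s t. \<Sum>i\<in>V. \<Sum>j\<in>V. u s i * B i j * u t j)"
  unfolding psd_on_def
proof (intro conjI ballI allI)
  fix s t
  have "(\<Sum>i\<in>V. \<Sum>j\<in>V. u s i * B i j * u t j) = (\<Sum>i\<in>V. \<Sum>j\<in>V. u s i * B j i * u t j)"
    using assms by (intro sum.cong) (auto simp: psd_on_def)
  also have "\<dots> = (\<Sum>i\<in>V. \<Sum>j\<in>V. u t i * B i j * u s j)"
    by (subst sum.swap) (simp add: mult_ac)
  finally show "(\<Sum>i\<in>V. \<Sum>j\<in>V. u s i * B i j * u t j) = (\<Sum>i\<in>V. \<Sum>j\<in>V. u t i * B i j * u s j)" .
next
  fix x :: "'b \<Rightarrow> real"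
  have "(\<Sum>s\<in>I. \<Sum>t\<in>I. x s * (\<Sum>i\<in>V. \<Sum>j\<in>V. u s i * B i j * u t j) * x t)
      = (\<Sum>s\<in>I. \<Sum>t\<in>I. \<Sum>i\<in>V. \<Sum>j\<in>V. (x s * u s i) * B i j * (x t * u t j))"
    by (simp add: sum_distrib_left sum_distrib_right mult_ac)
  also have "\<dots> = (\<Sum>s\<in>I. \<Sum>i\<in>V. \<Sum>j\<in>V. \<Sum>t\<in>I. (x s * u s i) * B i j * (x t * u t j))"
    by (subst sum.swap[of _ V I], rule sum.cong[OF refl], rule sum.cong[OF refl], rule sum.swap)
  also have "\<dots> = (\<Sum>i\<in>V. \<Sum>j\<in>V. \<Sum>s\<in>I. \<Sum>t\<in>I. (x s * u s i) * B i j * (x t * u t j))"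
    by (subst sum.swap, rule sum.cong[OF refl], rule sum.swap)
  also have "\<dots> = (\<Sum>i\<in>V. \<Sum>j\<in>V. (\<Sum>s\<in>I. x s * u s i) * B i j * (\<Sum>t\<in>I. x t * u t j))"
    by (simp add: sum_distrib_left sum_distrib_right mult_ac)
  also have "\<dots> \<ge> 0"
    by (rule psd_onD[OF assms])
  finally show "0 \<le> (\<Sum>s\<in>I. \<Sum>t\<in>I. x s * (\<Sum>i\<in>V. \<Sum>j\<in>V. u s i * B i j * u t j) * x t)" .
qed

definition form_on :: "'a set \<Rightarrow> ('a \<Rightarrow> 'a \<Rightarrow> real) \<Rightarrow> ('a \<Rightarrow> 'a \<Rightarrow> real) \<Rightarrow> real" where
  "form_on V M B = (\<Sum>i\<in>V. \<Sum>j\<in>V. M i j * B i j)"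

text \<open>Self-duality of the positive semidefinite cone makes this say that \<open>M - J\<close> is positive
  semidefinite, \<open>J\<close> being the all-ones matrix.\<close>

definition dominates_ones :: "'a set \<Rightarrow> ('a \<Rightarrow> 'a \<Rightarrow> real) \<Rightarrow> bool" where
  "dominates_ones V M \<longleftrightarrow> (\<forall>B. psd_on V B \<longrightarrow> form_on V (\<lambda>_ _. 1) B \<le> form_on V M B)"

lemma bdd_above_theta:
  assumes "finite V"
  shows "bdd_above {(\<Sum>i\<in>V. \<Sum>j\<in>V. B i j) | B.
       psd_on V B \<and> (\<Sum>i\<in>V. B i i) = 1 \<and> (\<forall>i\<in>V. \<forall>j\<in>V. E i j \<longrightarrow> B i j = 0)}"
  by (rule bdd_aboveI[where M = "real (card V)"]) (use psd_on_sum_le[OF assms] in fastforce)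

lemma theta_upper:
  assumes "finite V" "psd_on V B" "(\<Sum>i\<in>V. B i i) = 1" "\<forall>i\<in>V. \<forall>j\<in>V. E i j \<longrightarrow> B i j = 0"
  shows "(\<Sum>i\<in>V. \<Sum>j\<in>V. B i j) \<le> lovasz_theta V E"
  unfolding lovasz_theta_def by (rule cSup_upper[OF _ bdd_above_theta]) (use assms in auto)

text \<open>The witness is the matrix unit at \<open>(v, v)\<close>. It makes the feasible set
  nonempty, and pairing with it reads off a diagonal entry.\<close>

lemma point_mass_feasible:
  assumes "finite V" "v \<in> V" "\<not> E v v"
  obtains B where "psd_on V B" "(\<Sum>i\<in>V. B i i) = 1" "\<forall>i\<in>V. \<forall>j\<in>V. E i j \<longrightarrow> B i j = 0"
    "\<And>M. form_on V M B = M v v"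
proof
  let ?x = "\<lambda>i. if i = v then 1 else (0::real)"
  show "psd_on V (\<lambda>i j. ?x i * ?x j)" by (rule psd_on_rank_one)
  have *: "?x i * ?x i = ?x i" for i by simp
  show "(\<Sum>i\<in>V. ?x i * ?x i) = 1" unfolding * using assms by simp
  show "\<forall>i\<in>V. \<forall>j\<in>V. E i j \<longrightarrow> ?x i * ?x j = 0" using assms by auto
  have "M i j * (?x i * ?x j) = (if j = v then if i = v then M i j else 0 else 0)" for M :: "'a \<Rightarrow> 'a \<Rightarrow> real" and i j
    by simp
  then show "form_on V M (\<lambda>i j. ?x i * ?x j) = M v v" for M
    using assms by (simp add: form_on_def)
qed

lemma theta_ge_1:
  assumes "finite V" "v \<in> V" "\<not> E v v"
  shows "1 \<le> lovasz_theta V E"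
proof -
  obtain B where B: "psd_on V B" "(\<Sum>i\<in>V. B i i) = 1" "\<forall>i\<in>V. \<forall>j\<in>V. E i j \<longrightarrow> B i j = 0"
    "\<And>M. form_on V M B = M v v"
    using point_mass_feasible[where E = E and V = V, OF assms] by blast
  show ?thesis
    using theta_upper[OF assms(1) B(1-3)] B(4)[of "\<lambda>_ _. 1"] by (simp add: form_on_def)
qed

text \<open>One matrix serves both graphs. Rescaled to trace 1, \<open>M\<close> is feasible for
  \<open>E\<close>. A matrix feasible for the complement lives on the diagonal and the edges, so its
  pairing with \<open>M\<close> sees only the diagonal and equals \<open>d\<close>.\<close>

lemma theta_bounds:
  assumes "finite V" and "V \<noteq> {}"
    and sym: "\<And>i j. M i j = M j i" and diag: "\<And>i. i \<in> V \<Longrightarrow> M i i = d"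
    and zero: "\<And>i j. i \<in> V \<Longrightarrow> j \<in> V \<Longrightarrow> E i j \<Longrightarrow> M i j = 0"
    and dom: "dominates_ones V M"
  shows "1 \<le> d" "lovasz_theta V (compl_graph V E) \<le> d" "real (card V) / d \<le> lovasz_theta V E"
proof -
  obtain v where v: "v \<in> V" using assms by blast
  obtain B0 where B0: "psd_on V B0" "(\<Sum>i\<in>V. B0 i i) = 1"
      "\<forall>i\<in>V. \<forall>j\<in>V. compl_graph V E i j \<longrightarrow> B0 i j = 0" "\<And>M. form_on V M B0 = M v v"
    using point_mass_feasible[where E = "compl_graph V E" and V = V and v = v] assms(1) v
    by (auto simp: compl_graph_def)
  show d: "1 \<le> d"
  proof -
    have "form_on V (\<lambda>_ _. 1) B0 \<le> form_on V M B0"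
      using dom B0(1) unfolding dominates_ones_def by blast
    then show ?thesis by (simp add: B0(4) diag[OF v])
  qed
  show "lovasz_theta V (compl_graph V E) \<le> d"
    unfolding lovasz_theta_def
  proof (rule cSup_least)
    show "{(\<Sum>i\<in>V. \<Sum>j\<in>V. B i j) | B. psd_on V B \<and> (\<Sum>i\<in>V. B i i) = 1 \<and>
        (\<forall>i\<in>V. \<forall>j\<in>V. compl_graph V E i j \<longrightarrow> B i j = 0)} \<noteq> {}"
      using B0(1-3) by blast
  next
    fix s assume "s \<in> {(\<Sum>i\<in>V. \<Sum>j\<in>V. B i j) | B. psd_on V B \<and> (\<Sum>i\<in>V. B i i) = 1 \<and>
        (\<forall>i\<in>V. \<forall>j\<in>V. compl_graph V E i j \<longrightarrow> B i j = 0)}"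
    then obtain B where B: "psd_on V B" "(\<Sum>i\<in>V. B i i) = 1" "s = (\<Sum>i\<in>V. \<Sum>j\<in>V. B i j)"
        "\<And>i j. i \<in> V \<Longrightarrow> j \<in> V \<Longrightarrow> compl_graph V E i j \<Longrightarrow> B i j = 0"
      by blast
    have "s = form_on V (\<lambda>_ _. 1) B"
      by (simp add: form_on_def B(3))
    also have "\<dots> \<le> form_on V M B"
      using dom B(1) by (simp add: dominates_ones_def)
    also have "\<dots> = (\<Sum>i\<in>V. \<Sum>j\<in>V. if i = j then d * B i i else 0)"
      unfolding form_on_def
    proof (intro sum.cong refl)
      fix i j assume "i \<in> V" "j \<in> V"
      then show "M i j * B i j = (if i = j then d * B i i else 0)"
        using zero[of i j] diag[of i] B(4)[of i j] by (auto simp: compl_graph_def)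
    qed
    also have "\<dots> = d"
      using assms(1) B(2) by (simp add: sum.delta flip: sum_distrib_left)
    finally show "s \<le> d" .
  qed
  have N: "real (card V) > 0" using assms by (simp add: card_gt_0_iff)
  define B where "B = (\<lambda>i j. M i j / (d * card V))"
  have "psd_on V B"
    unfolding psd_on_def
  proof (intro conjI ballI allI)
    show "B i j = B j i" for i j by (simp add: B_def sym)
    fix x :: "'a \<Rightarrow> real"
    \<comment> \<open>Domination tested on rank-one matrices shows that \<open>M\<close> is itself
      positive semidefinite.\<close>
    have "0 \<le> (\<Sum>i\<in>V. x i)\<^sup>2" by simp
    also have "\<dots> = form_on V (\<lambda>_ _. 1) (\<lambda>i j. x i * x j)"
      by (simp add: form_on_def power2_eq_square sum_product)
    also have "\<dots> \<le> form_on V M (\<lambda>i j. x i * x j)"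
      using dom psd_on_rank_one[of V x] unfolding dominates_ones_def by blast
    finally have "0 \<le> form_on V M (\<lambda>i j. x i * x j) / (d * card V)"
      using d N by simp
    also have "\<dots> = (\<Sum>i\<in>V. \<Sum>j\<in>V. x i * B i j * x j)"
      by (simp add: form_on_def B_def sum_divide_distrib mult_ac)
    finally show "0 \<le> (\<Sum>i\<in>V. \<Sum>j\<in>V. x i * B i j * x j)" .
  qed
  moreover have "(\<Sum>i\<in>V. B i i) = 1"
    using d N by (simp add: B_def diag)
  ultimately have "(\<Sum>i\<in>V. \<Sum>j\<in>V. B i j) \<le> lovasz_theta V E"
    by (intro theta_upper) (auto simp: assms(1) B_def zero)
  \<comment> \<open>Domination tested on the all-ones matrix: the entries of \<open>M\<close> sum to
    at least the square of \<open>card V\<close>.\<close>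
  moreover have "form_on V (\<lambda>_ _. 1) (\<lambda>_ _. 1) \<le> form_on V M (\<lambda>_ _. 1)"
    using dom psd_on_rank_one[of V "\<lambda>_. 1"] unfolding dominates_ones_def mult_1 by blast
  then have "form_on V (\<lambda>_ _. 1) (\<lambda>_ _. 1) / (d * card V) \<le> form_on V M (\<lambda>_ _. 1) / (d * card V)"
    using d by (intro divide_right_mono) auto
  moreover have "\<dots> = (\<Sum>i\<in>V. \<Sum>j\<in>V. B i j)"
    by (simp add: B_def form_on_def sum_divide_distrib)
  moreover have "form_on V (\<lambda>_ _. 1) (\<lambda>_ _. 1) / (d * card V) = real (card V) / d"
    using N by (simp add: form_on_def)
  ultimately show "real (card V) / d \<le> lovasz_theta V E"
    by linarith
qed

subsection \<open>Inclusion matrices\<close>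

text \<open>Both sides count the \<open>i\<close>-subsets of \<open>A \<inter> B\<close>. The right
  side is an inner product of 0/1 incidence vectors over the naturals, usable both over the reals
  and modulo \<open>p\<close>.\<close>

lemma binomial_card_Int:
  assumes "A \<subseteq> {1..n}" "B \<subseteq> {1..n}"
  shows "card (A \<inter> B) choose i = (\<Sum>T\<in>johnson_vertices n i. of_bool (T \<subseteq> A) * of_bool (T \<subseteq> B))"
proof -
  have fin: "finite (A \<inter> B)" using assms by (meson finite_Int finite_atLeastAtMost finite_subset)
  have "(\<Sum>T\<in>johnson_vertices n i. of_bool (T \<subseteq> A) * of_bool (T \<subseteq> B))
      = card (johnson_vertices n i \<inter> {T. T \<subseteq> A \<and> T \<subseteq> B})"
    by (simp flip: of_bool_conj)
  also have "johnson_vertices n i \<inter> {T. T \<subseteq> A \<and> T \<subseteq> B} = {T. T \<subseteq> A \<inter> B \<and> card T = i}"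
    using assms by (auto simp: johnson_vertices_def)
  finally show ?thesis using n_subsets[OF fin] by simp
qed

abbreviation inclusion :: "nat \<Rightarrow> nat set \<Rightarrow> nat set \<Rightarrow> real" where
  "inclusion i \<equiv> \<lambda>A B. real (card (A \<inter> B) choose i)"

text \<open>The Gram factorisation turns the pairing into a sum of values of the quadratic form of
  \<open>B\<close>, one at the incidence vector of each \<open>i\<close>-set
  \<open>T\<close>.\<close>

lemma form_inclusion:
  "form_on (johnson_vertices n k) (inclusion i) B =
     (\<Sum>T\<in>johnson_vertices n i. \<Sum>A\<in>johnson_vertices n k. \<Sum>C\<in>johnson_vertices n k.
        of_bool (T \<subseteq> A) * B A C * of_bool (T \<subseteq> C))"
proof -
  have "form_on (johnson_vertices n k) (inclusion i) B =
     (\<Sum>A\<in>johnson_vertices n k. \<Sum>C\<in>johnson_vertices n k. \<Sum>T\<in>johnson_vertices n i.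
        of_bool (T \<subseteq> A) * B A C * of_bool (T \<subseteq> C))"
    unfolding form_on_def
  proof (intro sum.cong refl)
    fix A C assume "A \<in> johnson_vertices n k" "C \<in> johnson_vertices n k"
    then have AC: "A \<subseteq> {1..n}" "C \<subseteq> {1..n}" by (auto simp: johnson_vertices_def)
    show "inclusion i A C * B A C
        = (\<Sum>T\<in>johnson_vertices n i. of_bool (T \<subseteq> A) * B A C * of_bool (T \<subseteq> C))"
      unfolding binomial_card_Int[OF AC]
      by (simp only: of_nat_sum of_nat_mult of_nat_of_bool sum_distrib_left sum_distrib_right mult_ac)
  qed
  also have "\<dots> = (\<Sum>A\<in>johnson_vertices n k. \<Sum>T\<in>johnson_vertices n i. \<Sum>C\<in>johnson_vertices n k.
        of_bool (T \<subseteq> A) * B A C * of_bool (T \<subseteq> C))"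
    by (rule sum.cong[OF refl], rule sum.swap)
  also have "\<dots> = (\<Sum>T\<in>johnson_vertices n i. \<Sum>A\<in>johnson_vertices n k. \<Sum>C\<in>johnson_vertices n k.
        of_bool (T \<subseteq> A) * B A C * of_bool (T \<subseteq> C))"
    by (rule sum.swap)
  finally show ?thesis .
qed

lemma form_inclusion_nonneg:
  assumes "psd_on (johnson_vertices n k) B"
  shows "0 \<le> form_on (johnson_vertices n k) (inclusion i) B"
  unfolding form_inclusion by (intro sum_nonneg psd_onD assms)

text \<open>Double counting of pairs of a set and a marked element: each set of size
  \<open>z + 1\<close> arises by inserting any one of its elements.\<close>

lemma sum_one_point_extensions:
  fixes h :: "nat set \<Rightarrow> real"
  shows "(\<Sum>T\<in>johnson_vertices n z. \<Sum>e\<in>{1..n}-T. h (insert e T))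
    = real (z + 1) * (\<Sum>T\<in>johnson_vertices n (Suc z). h T)"
proof -
  have fin: "finite T" if "T \<in> johnson_vertices n m" for T m
    using that by (auto simp: johnson_vertices_def intro: finite_subset)
  have "(\<Sum>T\<in>johnson_vertices n z. \<Sum>e\<in>{1..n}-T. h (insert e T))
     = (\<Sum>(T, e)\<in>Sigma (johnson_vertices n z) (\<lambda>T. {1..n} - T). h (insert e T))"
    by (subst sum.Sigma) auto
  also have "\<dots> = (\<Sum>(T, e)\<in>Sigma (johnson_vertices n (Suc z)) (\<lambda>T. T). h T)"
    by (rule sum.reindex_bij_witness[where i = "\<lambda>(T, e). (T - {e}, e)" and j = "\<lambda>(T, e). (insert e T, e)"])
      (auto simp: johnson_vertices_def insert_absorb card_insert_if card_Diff_singleton_if dest: finite_subset)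
  also have "\<dots> = (\<Sum>T\<in>johnson_vertices n (Suc z). \<Sum>e\<in>T. h T)"
    using fin by (subst sum.Sigma) auto
  also have "\<dots> = (\<Sum>T\<in>johnson_vertices n (Suc z). real (z + 1) * h T)"
    by (rule sum.cong) (auto simp: johnson_vertices_def)
  finally show ?thesis by (simp only: sum_distrib_left)
qed

lemma card_one_point_extensions:
  assumes "T \<in> johnson_vertices n z" "A \<in> johnson_vertices n k" "z \<le> k"
  shows "real (k - z) * of_bool (T \<subseteq> A) = (\<Sum>e\<in>{1..n}-T. of_bool (insert e T \<subseteq> A))"
proof (cases "T \<subseteq> A")
  case True
  have "(\<Sum>e\<in>{1..n}-T. of_bool (insert e T \<subseteq> A)) = (\<Sum>e\<in>{1..n}-T. of_bool (e \<in> A) :: real)"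
    using True by simp
  also have "\<dots> = real (card (A - T))"
    using assms by (auto simp: of_bool_def sum.If_cases johnson_vertices_def intro!: arg_cong[of _ _ card])
  also have "card (A - T) = k - z"
    using assms True by (auto simp: johnson_vertices_def card_Diff_subset finite_subset)
  finally show ?thesis using True by simp
qed auto

text \<open>Each \<open>A\<close> containing a \<open>z\<close>-set \<open>T\<close> contains \<open>k - z\<close> one-point extensions of \<open>T\<close>, so the
  incidence vector of \<open>T\<close> is, up to that factor, the sum of those of its extensions; Cauchy-Schwarz
  for \<open>B\<close> gives the bound.\<close>

lemma form_inclusion_Suc:
  assumes "psd_on (johnson_vertices n k) B" "z < k"
  shows "form_on (johnson_vertices n k) (inclusion z) B
    \<le> real (n * k) * form_on (johnson_vertices n k) (inclusion (Suc z)) B"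
proof -
  let ?V = "johnson_vertices n k"
  define b where "b = (\<lambda>S T. \<Sum>A\<in>?V. \<Sum>C\<in>?V. of_bool (S \<subseteq> A) * B A C * of_bool (T \<subseteq> C))"
  have nonneg: "0 \<le> b T T" for T
    unfolding b_def by (rule psd_onD[OF assms(1)])
  have step: "b T T \<le> n * (\<Sum>e\<in>{1..n}-T. b (insert e T) (insert e T))"
    if T: "T \<in> johnson_vertices n z" for T
  proof -
    \<comment> \<open>Since \<open>k - z\<close> is at least 1, its square may be inserted; it is
      then absorbed into the two incidence vectors.\<close>
    have "1 * b T T \<le> (real (k - z))\<^sup>2 * b T T"
      using assms(2) nonneg by (intro mult_right_mono) auto
    also have "\<dots> = (\<Sum>A\<in>?V. \<Sum>C\<in>?V. (real (k - z) * of_bool (T \<subseteq> A)) * B A C *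
        (real (k - z) * of_bool (T \<subseteq> C)))"
      by (simp add: b_def power2_eq_square sum_distrib_left mult_ac)
    also have "\<dots> = (\<Sum>A\<in>?V. \<Sum>C\<in>?V. (\<Sum>e\<in>{1..n}-T. of_bool (insert e T \<subseteq> A)) * B A C *
        (\<Sum>e\<in>{1..n}-T. of_bool (insert e T \<subseteq> C)))"
      by (intro sum.cong refl) (simp only: card_one_point_extensions[OF T _ less_imp_le[OF assms(2)]])
    also have "\<dots> = (\<Sum>A\<in>?V. \<Sum>C\<in>?V. \<Sum>e\<in>{1..n}-T. \<Sum>e'\<in>{1..n}-T.
        of_bool (insert e T \<subseteq> A) * B A C * of_bool (insert e' T \<subseteq> C))"
      by (simp only: sum_distrib_left sum_distrib_right)
        (rule sum.cong[OF refl], rule sum.cong[OF refl], rule sum.swap)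
    also have "\<dots> = (\<Sum>A\<in>?V. \<Sum>e\<in>{1..n}-T. \<Sum>e'\<in>{1..n}-T. \<Sum>C\<in>?V.
        of_bool (insert e T \<subseteq> A) * B A C * of_bool (insert e' T \<subseteq> C))"
      by (rule sum.cong[OF refl], subst sum.swap, rule sum.cong[OF refl], rule sum.swap)
    also have "\<dots> = (\<Sum>e\<in>{1..n}-T. \<Sum>e'\<in>{1..n}-T. b (insert e T) (insert e' T))"
      unfolding b_def by (subst sum.swap, rule sum.cong[OF refl], rule sum.swap)
    \<comment> \<open>Cauchy-Schwarz, for the matrix of the values of \<open>b\<close> indexed by
      the extension points \<open>e\<close> and \<open>e'\<close>.\<close>
    also have "\<dots> \<le> real (card ({1..n}-T)) * (\<Sum>e\<in>{1..n}-T. b (insert e T) (insert e T))"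
      unfolding b_def by (rule psd_on_sum_le[OF _ psd_on_congruence[OF assms(1)]]) simp
    also have "\<dots> \<le> n * (\<Sum>e\<in>{1..n}-T. b (insert e T) (insert e T))"
      using card_mono[of "{1..n}" "{1..n}-T"]
      by (intro mult_right_mono sum_nonneg nonneg) auto
    finally show ?thesis by simp
  qed
  have "form_on ?V (inclusion z) B = (\<Sum>T\<in>johnson_vertices n z. b T T)"
    by (simp add: form_inclusion b_def)
  also have "\<dots> \<le> (\<Sum>T\<in>johnson_vertices n z. n * (\<Sum>e\<in>{1..n}-T. b (insert e T) (insert e T)))"
    by (rule sum_mono[OF step])
  also have "\<dots> = real n * real (z + 1) * (\<Sum>T\<in>johnson_vertices n (Suc z). b T T)"
    by (simp only: sum_distrib_left[symmetric] mult.assoc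
        sum_one_point_extensions[where h = "\<lambda>T. b T T"])
  also have "\<dots> \<le> real n * real k * (\<Sum>T\<in>johnson_vertices n (Suc z). b T T)"
    using assms(2) by (intro mult_right_mono mult_left_mono sum_nonneg nonneg) auto
  also have "(\<Sum>T\<in>johnson_vertices n (Suc z). b T T) = form_on ?V (inclusion (Suc z)) B"
    by (simp add: form_inclusion b_def)
  finally show ?thesis by simp
qed

section \<open>Interpolation: forcing zeros at prescribed intersection sizes\<close>

lemma form_on_add: "form_on V (\<lambda>i j. M i j + M' i j) B = form_on V M B + form_on V M' B"
  by (simp add: form_on_def algebra_simps sum.distrib)

lemma form_on_scale: "form_on V (\<lambda>i j. c * M i j) B = c * form_on V M B"
  by (simp add: form_on_def sum_distrib_left mult.assoc)

text \<open>A negative \<open>c\<close> loses at most \<open>\<bar>c\<bar>\<close> times the pairing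
  with \<open>inclusion z\<close>, and \<open>form_inclusion_Suc\<close> pays for this with the next
  inclusion matrix.\<close>

lemma dominates_ones_add_inclusion:
  assumes "dominates_ones (johnson_vertices n k) (\<lambda>A B. f (card (A \<inter> B)))" "z < k"
  shows "dominates_ones (johnson_vertices n k) (\<lambda>A B. f (card (A \<inter> B)) +
     (c * inclusion z A B + \<bar>c\<bar> * real (n * k) * inclusion (Suc z) A B))"
  unfolding dominates_ones_def
proof (intro allI impI)
  fix B assume B: "psd_on (johnson_vertices n k) B"
  let ?F = "\<lambda>M. form_on (johnson_vertices n k) M B"
  have "- (c * ?F (inclusion z)) \<le> \<bar>c\<bar> * ?F (inclusion z)"
    using mult_right_mono[OF _ form_inclusion_nonneg[OF B, of z], of "- c" "\<bar>c\<bar>"] by auto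
  also have "\<dots> \<le> \<bar>c\<bar> * (real (n * k) * ?F (inclusion (Suc z)))"
    by (rule mult_left_mono[OF form_inclusion_Suc[OF B assms(2)]]) simp
  finally have "0 \<le> c * ?F (inclusion z) + \<bar>c\<bar> * real (n * k) * ?F (inclusion (Suc z))"
    by (simp add: mult.assoc)
  moreover have "?F (\<lambda>_ _. 1) \<le> ?F (\<lambda>A B. f (card (A \<inter> B)))"
    using assms B by (simp add: dominates_ones_def)
  ultimately show "?F (\<lambda>_ _. 1) \<le> ?F (\<lambda>A B. f (card (A \<inter> B)) +
     (c * inclusion z A B + \<bar>c\<bar> * real (n * k) * inclusion (Suc z) A B))"
    unfolding form_on_add form_on_scale by linarith
qed

text \<open>Increasing order matters: \<open>x choose z\<close> and \<open>x choose Suc z\<close>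
  vanish for \<open>x < z\<close>, so earlier zeros survive. Only the sizes in \<open>Z\<close> cost
  a factor \<open>n\<close>, and \<open>K\<close> is fixed before \<open>n\<close>.\<close>

lemma johnson_interpolation:
  assumes "z \<le> k"
  shows "\<exists>K\<ge>0. \<forall>n\<ge>1. \<exists>f :: nat \<Rightarrow> real. (\<forall>x<z. x \<in> Z \<longrightarrow> f x = 0) \<and>
    (\<forall>x\<le>k. \<bar>f x\<bar> \<le> K * real n ^ card (Z \<inter> {..<z})) \<and>
    dominates_ones (johnson_vertices n k) (\<lambda>A B. f (card (A \<inter> B)))"
  using assms
proof (induction z)
  case 0
  show ?case
    by (rule exI[of _ 1], simp, intro allI impI exI[of _ "\<lambda>_. 1"]) (simp add: dominates_ones_def)
next
  case (Suc z)
  then obtain K where K: "K \<ge> 0" "\<And>n. n \<ge> 1 \<Longrightarrow> \<exists>f :: nat \<Rightarrow> real. (\<forall>x<z. x \<in> Z \<longrightarrow> f x = 0) \<and>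
    (\<forall>x\<le>k. \<bar>f x\<bar> \<le> K * real n ^ card (Z \<inter> {..<z})) \<and>
    dominates_ones (johnson_vertices n k) (\<lambda>A B. f (card (A \<inter> B)))"
    by auto
  show ?case
  proof (cases "z \<in> Z")
    case False
    then have "Z \<inter> {..<Suc z} = Z \<inter> {..<z}" and "\<And>f. (\<forall>x<Suc z. x \<in> Z \<longrightarrow> f x = 0) \<longleftrightarrow> (\<forall>x<z. x \<in> Z \<longrightarrow> f x = (0::real))"
      by (auto simp: less_Suc_eq)
    then show ?thesis using K by auto
  next
    case True
    then have "Z \<inter> {..<Suc z} = insert z (Z \<inter> {..<z})" by auto
    then have card: "card (Z \<inter> {..<Suc z}) = Suc (card (Z \<inter> {..<z}))" by simp
    let ?m = "card (Z \<inter> {..<z})"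
    \<comment> \<open>The three summands bound the three terms of \<open>g\<close> below, with every
      binomial coefficient at most \<open>2 ^ k\<close>.\<close>
    let ?K = "K * (1 + 2 ^ k + k * 2 ^ k)"
    show ?thesis
    proof (intro exI[of _ ?K] conjI allI impI)
      show "0 \<le> ?K" using K(1) by simp
      fix n :: nat assume n: "1 \<le> n"
      obtain f :: "nat \<Rightarrow> real" where f: "\<And>x. x < z \<Longrightarrow> x \<in> Z \<Longrightarrow> f x = 0"
        "\<And>x. x \<le> k \<Longrightarrow> \<bar>f x\<bar> \<le> K * real n ^ ?m"
        "dominates_ones (johnson_vertices n k) (\<lambda>A B. f (card (A \<inter> B)))"
        using K(2)[OF n] by blast
      \<comment> \<open>At \<open>x = z\<close> the two binomials are 1 and 0, so
        \<open>g z = f z + c\<close>.\<close>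
      define c where "c = - f z"
      define g where "g = (\<lambda>x. f x + (c * (x choose z) + \<bar>c\<bar> * real (n * k) * (x choose Suc z)))"
      have "\<bar>g x\<bar> \<le> ?K * real n ^ Suc ?m" if x: "x \<le> k" for x
      proof -
        define t where "t = K * real n ^ ?m"
        have t0: "0 \<le> t" using K(1) by (simp add: t_def)
        have bin: "real (x choose i) \<le> 2 ^ k" for i
        proof -
          have "x choose i \<le> 2 ^ x" by (rule binomial_le_pow2)
          also have "\<dots> \<le> 2 ^ k" using x by simp
          finally show ?thesis by (metis of_nat_le_iff of_nat_numeral of_nat_power)
        qed
        have c: "\<bar>c\<bar> \<le> t" using f(2)[of z] Suc.prems by (simp add: c_def t_def)
        have "\<bar>g x\<bar> \<le> \<bar>f x\<bar> + (\<bar>c\<bar> * (x choose z) + \<bar>c\<bar> * real (n * k) * (x choose Suc z))"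
          unfolding g_def by (intro order_trans[OF abs_triangle_ineq] add_mono) (auto simp: abs_mult)
        also have "\<dots> \<le> t + (t * 2 ^ k + t * (n * k) * 2 ^ k)"
          using f(2)[OF x] c t0 bin by (intro add_mono mult_mono) (auto simp: t_def)
        also have "\<dots> \<le> t * n + (t * n * 2 ^ k + t * (n * k) * 2 ^ k)"
          using n t0 by (intro add_mono mult_right_mono) (auto simp: mult_le_cancel_left1)
        also have "\<dots> = ?K * real n ^ Suc ?m"
          by (simp add: t_def algebra_simps)
        finally show ?thesis .
      qed
      moreover have "g x = 0" if "x < Suc z" "x \<in> Z" for x
      proof (cases "x = z")
        case False
        then have "x < z" using that by simp
        then show ?thesis using that f(1)[of x] by (simp add: g_def binomial_eq_0)
      qed (simp add: g_def c_def)
      moreover have "dominates_ones (johnson_vertices n k) (\<lambda>A B. g (card (A \<inter> B)))"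
        unfolding g_def using dominates_ones_add_inclusion[OF f(3)] Suc.prems by simp
      ultimately show "\<exists>f. (\<forall>x<Suc z. x \<in> Z \<longrightarrow> f x = 0) \<and>
         (\<forall>x\<le>k. \<bar>f x\<bar> \<le> ?K * real n ^ card (Z \<inter> {..<Suc z})) \<and>
         dominates_ones (johnson_vertices n k) (\<lambda>A B. f (card (A \<inter> B)))"
        unfolding card by blast
    qed
  qed
qed

lemma card_Int_less:
  assumes "A \<in> johnson_vertices n k" "B \<in> johnson_vertices n k" "A \<noteq> B"
  shows "card (A \<inter> B) < k"
proof -
  have fin: "finite A" "finite B" and c: "card A = k" "card B = k"
    using assms by (auto simp: johnson_vertices_def intro: finite_subset)
  have "\<not> A \<subseteq> B" using assms(3) c card_subset_eq[OF fin(2)] by metis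
  then have "A \<inter> B \<subset> A" by blast
  then show ?thesis using psubset_card_mono[OF fin(1)] c by simp
qed

text \<open>Interpolate with \<open>Z\<close> the complement of \<open>L\<close>. Adjacent vertices
  meet in a size below \<open>k\<close> outside \<open>L\<close>, where \<open>f\<close> vanishes,
  and the diagonal is constantly \<open>f k\<close>.\<close>

lemma theta_johnson_bounds:
  "\<exists>K>0. \<forall>n\<ge>k. n \<ge> 1 \<longrightarrow>
     lovasz_theta (johnson_vertices n k) (compl_graph (johnson_vertices n k) (johnson_adj L))
       \<le> K * real n ^ card ({..<k} - L) \<and>
     real (n choose k) / (K * real n ^ card ({..<k} - L)) \<le> lovasz_theta (johnson_vertices n k) (johnson_adj L)"
proof -
  obtain K where K: "K \<ge> 0" "\<And>n. n \<ge> 1 \<Longrightarrow> \<exists>f :: nat \<Rightarrow> real. (\<forall>x<k. x \<in> -L \<longrightarrow> f x = 0) \<and>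
    (\<forall>x\<le>k. \<bar>f x\<bar> \<le> K * real n ^ card (-L \<inter> {..<k})) \<and>
    dominates_ones (johnson_vertices n k) (\<lambda>A B. f (card (A \<inter> B)))"
    using johnson_interpolation[of k k "-L"] by blast
  have eq: "-L \<inter> {..<k} = {..<k} - L" by auto
  show ?thesis
  proof (intro exI[of _ "K + 1"] conjI allI impI)
    show "0 < K + 1" using K by simp
    fix n assume n: "k \<le> n" "1 \<le> n"
    let ?V = "johnson_vertices n k" and ?m = "card ({..<k} - L)"
    obtain f :: "nat \<Rightarrow> real" where f: "\<And>x. x < k \<Longrightarrow> x \<notin> L \<Longrightarrow> f x = 0"
        "\<And>x. x \<le> k \<Longrightarrow> \<bar>f x\<bar> \<le> K * real n ^ ?m"
        "dominates_ones ?V (\<lambda>A B. f (card (A \<inter> B)))"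
      using K(2)[OF n(2)] unfolding eq by blast
    have ne: "?V \<noteq> {}" using card_johnson[of n k] n by (metis binomial_eq_0_iff card.empty not_less)
    have z: "f (card (A \<inter> B)) = 0" if "A \<in> ?V" "B \<in> ?V" "johnson_adj L A B" for A B
      using that f(1) card_Int_less by (simp add: johnson_adj_def)
    have b: "1 \<le> f k" "lovasz_theta ?V (compl_graph ?V (johnson_adj L)) \<le> f k"
      "real (card ?V) / f k \<le> lovasz_theta ?V (johnson_adj L)"
      using theta_bounds[of ?V "\<lambda>A B. f (card (A \<inter> B))" "f k" "johnson_adj L"] ne f(3) z
      by (auto simp: johnson_adj_def Int_commute johnson_vertices_def)
    have fk: "f k \<le> (K + 1) * real n ^ ?m"
      using f(2)[of k] by (simp add: algebra_simps) (smt (verit) zero_le_power of_nat_0_le_iff)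
    then show "lovasz_theta ?V (compl_graph ?V (johnson_adj L)) \<le> (K + 1) * real n ^ ?m"
      using b(2) by linarith
    have "real (n choose k) / ((K + 1) * real n ^ ?m) \<le> real (card ?V) / f k"
      using fk b(1) by (simp add: frac_le)
    then show "real (n choose k) / ((K + 1) * real n ^ ?m) \<le> lovasz_theta ?V (johnson_adj L)"
      using b(3) by linarith
  qed
qed

subsection \<open>Independence modulo a prime\<close>

text \<open>In \<open>(x + 1) * (x choose (p - 1)) = p * ((x + 1) choose p)\<close>, the prime must
  divide the second factor on the left.\<close>

lemma prime_dvd_binomial_pred:
  assumes "prime (p::nat)" "\<not> p dvd Suc x"
  shows "p dvd x choose (p - 1)"
proof -
  have "Suc (p - 1) = p" using prime_gt_0_nat[OF assms(1)] by simp
  then have "Suc x * (x choose (p - 1)) = p * (Suc x choose p)"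
    using Suc_times_binomial_eq[of x "p - 1"] by (simp add: mult.commute)
  then have "p dvd Suc x * (x choose (p - 1))" by simp
  then show ?thesis using assms prime_dvd_mult_iff by blast
qed

text \<open>Induction through \<open>(j + 1) * (k choose (j + 1)) = (k - j) * (k choose j)\<close>:
  modulo \<open>p\<close>, \<open>k - j\<close> is \<open>-(j + 1)\<close>, which is nonzero while
  \<open>j + 1 < p\<close>.\<close>

lemma prime_not_dvd_binomial:
  assumes "prime (p::nat)" "p dvd Suc k" "j < p"
  shows "\<not> p dvd k choose j"
  using assms(3)
proof (induction j)
  case 0
  then show ?case using assms(1) by (simp add: prime_nat_iff)
next
  case (Suc j)
  have jk: "j < k" using Suc.prems dvd_imp_le[OF assms(2)] by simp
  show ?case
  proof
    assume "p dvd k choose Suc j"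
    then have "p dvd Suc j * (k choose Suc j)" by simp
    also have "Suc j * (k choose Suc j) = (k - j) * (k choose j)"
      by (simp only: binomial_absorb_comp binomial_absorption)
    finally have "p dvd k - j"
      using Suc assms(1) prime_dvd_mult_iff by auto
    then have "p dvd Suc k - (k - j)" using assms(2) dvd_diff_nat by blast
    then show False using jk Suc.prems by (auto dest: dvd_imp_le)
  qed
qed

text \<open>The combinations of the \<open>u s\<close> with coefficients in \<open>{..<p}\<close> are distinct modulo \<open>p\<close>, since pairing
  with \<open>u r\<close> recovers the coefficient of \<open>r\<close>; hence \<open>p ^ card S \<le> p ^ card D\<close>.\<close>

lemma modular_independence_bound:
  fixes u :: "'a \<Rightarrow> 't \<Rightarrow> nat"
  assumes p: "prime p" and "finite S" "finite D"
    and diag: "\<And>s. s \<in> S \<Longrightarrow> \<not> p dvd (\<Sum>t\<in>D. u s t * u s t)"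
    and off: "\<And>s s'. s \<in> S \<Longrightarrow> s' \<in> S \<Longrightarrow> s \<noteq> s' \<Longrightarrow> p dvd (\<Sum>t\<in>D. u s t * u s' t)"
  shows "card S \<le> card D"
proof -
  define \<Phi> where "\<Phi> = (\<lambda>a. \<lambda>t\<in>D. (\<Sum>s\<in>S. a s * u s t) mod p)"
  have p0: "p > 0" "p > 1" using p prime_gt_0_nat prime_gt_1_nat by auto
  have recover: "(\<Sum>t\<in>D. \<Phi> a t * u r t) mod p = a r * (\<Sum>t\<in>D. u r t * u r t) mod p"
    if "r \<in> S" for a r
  proof -
    have "(\<Sum>t\<in>D. \<Phi> a t * u r t) mod p = (\<Sum>t\<in>D. (\<Sum>s\<in>S. a s * u s t) * u r t) mod p"
      by (subst (1 2) mod_sum_eq[symmetric]) (simp add: \<Phi>_def mod_mult_left_eq cong: sum.cong)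
    also have "(\<Sum>t\<in>D. (\<Sum>s\<in>S. a s * u s t) * u r t) = (\<Sum>s\<in>S. a s * (\<Sum>t\<in>D. u s t * u r t))"
      by (simp add: sum_distrib_left sum_distrib_right mult.assoc) (rule sum.swap)
    also have "\<dots> = a r * (\<Sum>t\<in>D. u r t * u r t) + (\<Sum>s\<in>S-{r}. a s * (\<Sum>t\<in>D. u s t * u r t))"
      using that assms(2) by (rule sum.remove[rotated])
    also have "\<dots> mod p = a r * (\<Sum>t\<in>D. u r t * u r t) mod p"
    proof -
      have "p dvd (\<Sum>s\<in>S-{r}. a s * (\<Sum>t\<in>D. u s t * u r t))"
        by (rule dvd_sum, rule dvd_mult, rule off) (use that in auto)
      then show ?thesis by (auto elim!: dvdE)
    qed
    finally show ?thesis .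
  qed
  have "inj_on \<Phi> (S \<rightarrow>\<^sub>E {..<p})"
  proof (rule inj_onI)
    fix a b assume ab: "a \<in> S \<rightarrow>\<^sub>E {..<p}" "b \<in> S \<rightarrow>\<^sub>E {..<p}" "\<Phi> a = \<Phi> b"
    show "a = b"
    proof (rule PiE_ext[OF ab(1,2)])
      fix r assume r: "r \<in> S"
      have "[a r * (\<Sum>t\<in>D. u r t * u r t) = b r * (\<Sum>t\<in>D. u r t * u r t)] (mod p)"
        using recover[OF r, of a] recover[OF r, of b] ab(3) by (simp add: cong_def)
      moreover have "coprime (\<Sum>t\<in>D. u r t * u r t) p"
        using diag[OF r] p by (metis coprime_commute prime_imp_coprime)
      ultimately have "[a r = b r] (mod p)" using cong_mult_rcancel_nat by blast
      then show "a r = b r" using ab r by (auto intro: cong_less_modulus_unique_nat)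
    qed
  qed
  moreover have "\<Phi> ` (S \<rightarrow>\<^sub>E {..<p}) \<subseteq> D \<rightarrow>\<^sub>E {..<p}"
    using p0 by (auto simp: \<Phi>_def)
  ultimately have "card (S \<rightarrow>\<^sub>E {..<p}) \<le> card (D \<rightarrow>\<^sub>E {..<p})"
    using assms(3) by (intro card_inj_on_le) (auto intro: finite_PiE)
  then have "p ^ card S \<le> p ^ card D"
    using assms(2,3) by (simp add: card_PiE)
  then show ?thesis using p0(2) by simp
qed

subsection \<open>Independence number, chromatic number and Shannon capacity\<close>

text \<open>The capacity is a \<^const>\<open>lim\<close>, an unspecified value unless the sequence converges, which Fekete's
  lemma provides.\<close>

lemma superadditive_quotient_convergent:
  fixes a :: "nat \<Rightarrow> real" and C :: real
  assumes super: "\<And>m n. a m + a n \<le> a (m + n)" and nonneg: "\<And>m. 0 \<le> a m" and bound: "\<And>m. a m \<le> C * m"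
  shows "convergent (\<lambda>m. a m / m)"
proof -
  \<comment> \<open>The index 0 contributes the value 0, because division by zero yields 0.\<close>
  define L where "L = (SUP m. a m / m)"
  have C: "a m / m \<le> C" if "m > 0" for m using bound[of m] that by (simp add: field_simps)
  have C0: "0 \<le> C" using C[of 1] nonneg[of 1] by simp
  have bdd: "bdd_above (range (\<lambda>m. a m / m))"
  proof (rule bdd_aboveI[where M = C])
    fix y assume "y \<in> range (\<lambda>m. a m / m)"
    then obtain m where "y = a m / m" by blast
    then show "y \<le> C" using C[of m] C0 by (cases "m = 0") auto
  qed
  have le: "a m / m \<le> L" for m unfolding L_def by (rule cSUP_upper[OF _ bdd]) simp
  have mult: "q * a m \<le> a (q * m)" for q m :: nat
  proof (induction q)
    case (Suc q)
    then show ?case using super[of m "q * m"] by (simp add: algebra_simps)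
  qed (simp add: nonneg)
  have "(\<lambda>m. a m / m) \<longlonglongrightarrow> L"
  proof (rule order_tendstoI)
    fix y assume "L < y"
    then show "\<forall>\<^sub>F m in sequentially. a m / m < y" using le le_less_trans by (intro always_eventually) blast
  next
    fix y assume y: "y < L"
    then obtain m where m: "y < a m / m" using less_cSUP_iff[OF _ bdd] unfolding L_def by auto
    show "\<forall>\<^sub>F n in sequentially. y < a n / n"
    proof (cases "m = 0")
      case True
      then have "y < 0" using m by simp
      then show ?thesis using nonneg by (intro always_eventually) (meson divide_nonneg_nonneg less_le_trans of_nat_0_le_iff)
    next
      case False
      \<comment> \<open>Dividing \<open>n\<close> by \<open>m\<close> leaves a remainder below
        \<open>m\<close>, so \<open>a n\<close> is at least \<open>(n - m) * (a m / m)\<close>; this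
        sequence is that bound divided by \<open>n\<close>.\<close>
      have "(\<lambda>n. (1 - real m * inverse (real n)) * (a m / m)) \<longlonglongrightarrow> (1 - real m * 0) * (a m / m)"
        by (intro tendsto_intros lim_inverse_n)
      then have "\<forall>\<^sub>F n in sequentially. y < (1 - real m * inverse (real n)) * (a m / m)"
        using m by (intro order_tendstoD) auto
      then show ?thesis using eventually_gt_at_top[of 0]
      proof eventually_elim
        case (elim n)
        have "real n - real m \<le> real (n div m) * real m"
          by (metis False add.commute diff_le_eq div_mult_mod_eq less_eq_real_def mod_less_divisor
              mult.commute neq0_conv nless_le of_nat_add of_nat_le_iff of_nat_mult add_le_cancel_right nat_less_le)
        then have "(real n - real m) * (a m / m) \<le> real (n div m) * real m * (a m / m)"
          using nonneg by (intro mult_right_mono) auto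
        also have "\<dots> = real (n div m) * a m" using False by simp
        also have "\<dots> \<le> a (n div m * m)" by (rule mult)
        also have "\<dots> \<le> a (n div m * m) + a (n mod m)" using nonneg by simp
        also have "\<dots> \<le> a n" using super[of "n div m * m" "n mod m"] by simp
        finally have "(real n - real m) * (a m / m) / n \<le> a n / n" by (rule divide_right_mono) simp
        moreover have "(real n - real m) * (a m / m) / n = (1 - real m * inverse (real n)) * (a m / m)"
          using elim(2) by (simp add: field_simps)
        ultimately show ?case using elim(1) by linarith
      qed
    qed
  qed
  then show ?thesis by (auto simp: convergent_def)
qed

section \<open>Independent sets and colourings\<close>

lemma finite_independent:
  assumes "finite V"
  shows "finite {card S | S. independent V E S}"
proof -
  have "{card S | S. independent V E S} \<subseteq> card ` Pow V" by (auto simp: independent_def)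
  then show ?thesis using assms finite_subset by blast
qed

lemma alpha_upper:
  assumes "finite V" "independent V E S"
  shows "card S \<le> alpha V E"
  unfolding alpha_def by (rule Max_ge[OF finite_independent[OF assms(1)]]) (use assms in auto)

lemma alpha_attained:
  assumes "finite V"
  obtains S where "independent V E S" "card S = alpha V E"
proof -
  have "independent V E {}" by (simp add: independent_def)
  then have "{card S | S. independent V E S} \<noteq> {}" by blast
  from Max_in[OF finite_independent[OF assms] this] that show ?thesis
    unfolding alpha_def by auto
qed

lemma alpha_ge_1:
  assumes "finite V" "v \<in> V" "\<not> E v v"
  shows "1 \<le> alpha V E"
  using alpha_upper[OF assms(1), of E "{v}"] assms by (simp add: independent_def)

text \<open>The colour classes of an optimal colouring are independent and cover
  \<open>V\<close>.\<close>

lemma card_le_chi_mult_alpha: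
  assumes "finite V" "\<And>x. \<not> E x x"
  shows "card V \<le> chi V E * alpha V E"
proof -
  define P where "P = (\<lambda>k. \<exists>f :: 'a \<Rightarrow> nat. (\<forall>x\<in>V. f x < k) \<and> (\<forall>x\<in>V. \<forall>y\<in>V. E x y \<longrightarrow> f x \<noteq> f y))"
  obtain g :: "'a \<Rightarrow> nat" and m where "g ` V = {i. i < m}" "inj_on g V"
    using finite_imp_inj_to_nat_seg[OF assms(1)] by blast
  \<comment> \<open>An injective numbering is a proper colouring, so the minimum defining
    \<open>chi\<close> is attained.\<close>
  then have "P m" unfolding P_def
    using assms(2) by (intro exI[of _ g]) (auto dest: inj_onD)
  then have "P (chi V E)" unfolding chi_def P_def by (rule LeastI)
  then obtain f where f: "\<forall>x\<in>V. f x < chi V E" "\<forall>x\<in>V. \<forall>y\<in>V. E x y \<longrightarrow> f x \<noteq> f y"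
    unfolding P_def by blast
  have "V = (\<Union>i<chi V E. {x\<in>V. f x = i})" using f by auto
  then have "card V \<le> (\<Sum>i<chi V E. card {x\<in>V. f x = i})"
    by (metis card_UN_le finite_lessThan)
  also have "\<dots> \<le> (\<Sum>i<chi V E. alpha V E)"
    by (intro sum_mono alpha_upper[OF assms(1)]) (use f(2) in \<open>simp add: independent_def, metis\<close>)
  finally show ?thesis by simp
qed

section \<open>Strong powers and the Shannon capacity\<close>

lemma finite_strong_pow [simp]: "finite V \<Longrightarrow> finite (strong_pow_vertices V m)"
  using finite_lists_length_eq[of V m] by (simp add: strong_pow_vertices_def conj_commute)

lemma alpha_le_strong_pow_1:
  assumes "finite V" "\<And>x. \<not> E x x"
  shows "alpha V E \<le> alpha (strong_pow_vertices V 1) (strong_pow_adj E)"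
proof -
  obtain S where S: "independent V E S" "card S = alpha V E" using alpha_attained[OF assms(1)] .
  have "independent (strong_pow_vertices V 1) (strong_pow_adj E) ((\<lambda>x. [x]) ` S)"
    using S by (auto simp: independent_def strong_pow_vertices_def strong_pow_adj_def)
  from alpha_upper[OF _ this] show ?thesis using S assms by (simp add: card_image inj_on_def)
qed

lemma alpha_strong_pow_ge_1:
  assumes "finite V" "V \<noteq> {}"
  shows "1 \<le> alpha (strong_pow_vertices V m) (strong_pow_adj E)"
proof -
  obtain v where "v \<in> V" using assms by blast
  then have "replicate m v \<in> strong_pow_vertices V m" by (auto simp: strong_pow_vertices_def)
  then show ?thesis using assms by (intro alpha_ge_1) (auto simp: strong_pow_adj_def)
qed

text \<open>Concatenating members of two independent sets gives an independent set. Logarithms turn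
  this into the superadditivity that Fekete's lemma asks for.\<close>

lemma alpha_strong_pow_mult:
  assumes "finite V"
  shows "alpha (strong_pow_vertices V m) (strong_pow_adj E) * alpha (strong_pow_vertices V n) (strong_pow_adj E)
    \<le> alpha (strong_pow_vertices V (m + n)) (strong_pow_adj E)"
proof -
  let ?I = "\<lambda>m. independent (strong_pow_vertices V m) (strong_pow_adj E)"
  obtain S where S: "?I m S" "card S = alpha (strong_pow_vertices V m) (strong_pow_adj E)"
    using alpha_attained[OF finite_strong_pow[OF assms]] .
  obtain T where T: "?I n T" "card T = alpha (strong_pow_vertices V n) (strong_pow_adj E)"
    using alpha_attained[OF finite_strong_pow[OF assms]] .
  have len: "length xs = m" if "xs \<in> S" for xs
    using S that by (auto simp: independent_def strong_pow_vertices_def)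
  have len': "length xs = n" if "xs \<in> T" for xs
    using T that by (auto simp: independent_def strong_pow_vertices_def)
  have "?I (m + n) ((\<lambda>(xs, ys). xs @ ys) ` (S \<times> T))"
    unfolding independent_def
  proof (intro conjI ballI notI)
    show "(\<lambda>(xs, ys). xs @ ys) ` (S \<times> T) \<subseteq> strong_pow_vertices V (m + n)"
      using S(1) T(1) by (fastforce simp: independent_def strong_pow_vertices_def)
    fix u v assume "u \<in> (\<lambda>(xs, ys). xs @ ys) ` (S \<times> T)" "v \<in> (\<lambda>(xs, ys). xs @ ys) ` (S \<times> T)"
      and adj: "strong_pow_adj E u v"
    then obtain xs ys xs' ys' where in': "xs \<in> S" "ys \<in> T" "xs' \<in> S" "ys' \<in> T"
      and uv: "u = xs @ ys" "v = xs' @ ys'" by auto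
    have all: "u ! i = v ! i \<or> E (u ! i) (v ! i)" if "i < m + n" for i
      using adj that len len' in' by (simp add: strong_pow_adj_def uv)
    \<comment> \<open>The coordinatewise condition restricts to prefixes and suffixes; each pair of
      halves is equal or adjacent, and independence excludes the latter.\<close>
    have "xs ! i = xs' ! i \<or> E (xs ! i) (xs' ! i)" if "i < m" for i
      using all[of i] that len in' by (simp add: uv nth_append)
    then have "xs = xs' \<or> strong_pow_adj E xs xs'"
      using in' len by (simp add: strong_pow_adj_def)
    then have 1: "xs = xs'"
      using S(1) in' by (auto simp: independent_def)
    have "ys ! i = ys' ! i \<or> E (ys ! i) (ys' ! i)" if "i < n" for i
      using all[of "m + i"] that len in' by (simp add: uv nth_append)
    then have "ys = ys' \<or> strong_pow_adj E ys ys'"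
      using in' len' by (simp add: strong_pow_adj_def)
    then have "ys = ys'"
      using T(1) in' by (auto simp: independent_def)
    then show False using adj 1 uv by (simp add: strong_pow_adj_def)
  qed
  from alpha_upper[OF _ this]
  have "card ((\<lambda>(xs, ys). xs @ ys) ` (S \<times> T)) \<le> alpha (strong_pow_vertices V (m + n)) (strong_pow_adj E)"
    using assms by simp
  moreover have "inj_on (\<lambda>(xs, ys). xs @ ys) (S \<times> T)"
    by (rule inj_onI) (auto simp: len)
  ultimately show ?thesis using S T by (simp add: card_image card_cartesian_product)
qed

text \<open>Fekete's lemma for \<open>ln (a m)\<close> shows that the roots converge, so both bounds
  on them pass to the limit.\<close>

lemma shannon_capacity_bounds:
  assumes "finite V" "V \<noteq> {}"
    and R: "\<And>m. alpha (strong_pow_vertices V m) (strong_pow_adj E) \<le> R ^ m"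
  shows "1 \<le> shannon_capacity V E" "shannon_capacity V E \<le> R"
proof -
  define a where "a = (\<lambda>m. real (alpha (strong_pow_vertices V m) (strong_pow_adj E)))"
  have a1: "1 \<le> a m" for m
    using alpha_strong_pow_ge_1[OF assms(1,2)] by (simp add: a_def)
  have aR: "a m \<le> real R ^ m" for m
    using R[of m] unfolding a_def by (metis of_nat_le_iff of_nat_power)
  have R1: "1 \<le> real R" using a1[of 1] aR[of 1] by simp
  have "convergent (\<lambda>m. ln (a m) / m)"
  proof (rule superadditive_quotient_convergent[where C = "ln (real R)"])
    fix m n
    have "a m * a n \<le> a (m + n)"
      using alpha_strong_pow_mult[OF assms(1), of m E n] unfolding a_def
      by (metis of_nat_le_iff of_nat_mult)
    then have "ln (a m * a n) \<le> ln (a (m + n))"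
      using a1[of m] a1[of n] a1[of "m+n"] by (subst ln_le_cancel_iff) (auto intro: mult_pos_pos)
    then show "ln (a m) + ln (a n) \<le> ln (a (m + n))"
      using a1[of m] a1[of n] by (simp add: ln_mult)
    show "0 \<le> ln (a m)" using a1 by simp
    have "ln (a m) \<le> ln (real R ^ m)" using a1[of m] aR[of m] R1 by (subst ln_le_cancel_iff) auto
    then show "ln (a m) \<le> ln (real R) * m" using R1 by (simp add: ln_realpow mult.commute)
  qed
  then obtain l where "(\<lambda>m. ln (a m) / m) \<longlonglongrightarrow> l" by (auto simp: convergent_def)
  then have "(\<lambda>m. exp (ln (a m) / m)) \<longlonglongrightarrow> exp l" by (rule tendsto_exp)
  \<comment> \<open>This includes \<open>m = 0\<close>, where both sides are 1.\<close>
  moreover have "exp (ln (a m) / m) = a m powr (1 / m)" for m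
    using a1[of m] by (simp add: powr_def)
  ultimately have lim: "(\<lambda>m. a m powr (1 / m)) \<longlonglongrightarrow> exp l" by simp
  then have c: "shannon_capacity V E = exp l"
    unfolding shannon_capacity_def a_def by (rule limI)
  have "1 \<le> a m powr (1 / m)" for m using a1 by (simp add: ge_one_powr_ge_zero)
  then show "1 \<le> shannon_capacity V E" unfolding c by (intro LIMSEQ_le_const[OF lim]) auto
  have "a m powr (1 / m) \<le> R" if "m \<ge> 1" for m
  proof -
    have "a m powr (1 / m) \<le> (real R ^ m) powr (1 / m)"
      using a1[of m] by (intro powr_mono2 aR) auto
    also have "\<dots> = R" using R1 that by (simp add: powr_realpow[symmetric] powr_powr)
    finally show ?thesis .
  qed
  then show "shannon_capacity V E \<le> R" unfolding c by (intro LIMSEQ_le_const2[OF lim]) auto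
qed

subsection \<open>Johnson graphs with intersections avoiding a residue\<close>

text \<open>Tensor products of incidence vectors have the products of the coordinatewise binomials
  as inner products; one factor divisible by \<open>p\<close> kills the product.\<close>

lemma alpha_strong_pow_johnson_le:
  assumes p: "prime p" "p dvd Suc k" and L: "\<And>x. x \<in> L \<Longrightarrow> \<not> p dvd Suc x"
  shows "alpha (strong_pow_vertices (johnson_vertices n k) m) (strong_pow_adj (johnson_adj L))
    \<le> (n choose (p - 1)) ^ m"
proof -
  let ?V = "johnson_vertices n k" and ?W = "johnson_vertices n (p - 1)"
  let ?X = "strong_pow_vertices ?V m"
  obtain S where S: "independent ?X (strong_pow_adj (johnson_adj L)) S"
    "card S = alpha ?X (strong_pow_adj (johnson_adj L))"
    using alpha_attained[OF finite_strong_pow[OF finite_johnson]] .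
  have SX: "S \<subseteq> ?X" using S(1) by (simp add: independent_def)
  then have fin: "finite S" by (rule finite_subset) simp
  have V: "xs ! i \<in> ?V" if "xs \<in> S" "i < m" for xs i
    using SX that by (force simp: strong_pow_vertices_def)
  have len: "length xs = m" if "xs \<in> S" for xs
    using SX that by (auto simp: strong_pow_vertices_def)
  define D where "D = {..<m} \<rightarrow>\<^sub>E ?W"
  define u :: "nat set list \<Rightarrow> (nat \<Rightarrow> nat set) \<Rightarrow> nat" where
    "u = (\<lambda>xs T. \<Prod>i<m. of_bool (T i \<subseteq> xs ! i))"
  have gram: "(\<Sum>T\<in>D. u xs T * u ys T) = (\<Prod>i<m. card (xs ! i \<inter> ys ! i) choose (p - 1))"
    if "xs \<in> S" "ys \<in> S" for xs ys
  proof -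
    have "(\<Sum>T\<in>D. u xs T * u ys T)
        = (\<Sum>T\<in>D. \<Prod>i<m. of_bool (T i \<subseteq> xs ! i) * of_bool (T i \<subseteq> ys ! i))"
      by (simp only: u_def prod.distrib)
    also have "\<dots> = (\<Prod>i<m. \<Sum>T\<in>?W. of_bool (T \<subseteq> xs ! i) * of_bool (T \<subseteq> ys ! i))"
      unfolding D_def by (subst prod_sum_PiE) simp_all
    also have "\<dots> = (\<Prod>i<m. card (xs ! i \<inter> ys ! i) choose (p - 1))"
    proof (rule prod.cong[OF refl])
      fix i assume "i \<in> {..<m}"
      then have "xs ! i \<subseteq> {1..n}" "ys ! i \<subseteq> {1..n}"
        using V[OF that(1)] V[OF that(2)] by (auto simp: johnson_vertices_def)
      then show "(\<Sum>T\<in>?W. of_bool (T \<subseteq> xs ! i) * of_bool (T \<subseteq> ys ! i))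
          = card (xs ! i \<inter> ys ! i) choose (p - 1)"
        by (rule binomial_card_Int[symmetric])
    qed
    finally show ?thesis .
  qed
  have "card S \<le> card D"
  proof (rule modular_independence_bound[OF p(1) fin, where u = u])
    show "finite D" unfolding D_def by (intro finite_PiE) auto
    show "\<not> p dvd (\<Sum>T\<in>D. u xs T * u xs T)" if "xs \<in> S" for xs
    proof -
      have "\<not> p dvd card (xs ! i \<inter> xs ! i) choose (p - 1)" if "i < m" for i
        using V[OF \<open>xs \<in> S\<close> that] prime_not_dvd_binomial[OF p, of "p - 1"] prime_gt_0_nat[OF p(1)]
        by (simp add: johnson_vertices_def)
      then show ?thesis
        unfolding gram[OF that that] by (subst prime_dvd_prod_iff) (use p(1) in auto)
    qed
    show "p dvd (\<Sum>T\<in>D. u xs T * u ys T)" if "xs \<in> S" "ys \<in> S" "xs \<noteq> ys" for xs ys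
    proof -
      have "\<not> strong_pow_adj (johnson_adj L) xs ys" using S(1) that by (auto simp: independent_def)
      \<comment> \<open>Distinct nonadjacent lists have a coordinate where the entries are distinct
        and nonadjacent.\<close>
      then obtain i where i: "i < m" "card (xs ! i \<inter> ys ! i) \<in> L"
        using len[OF \<open>xs \<in> S\<close>] len[OF \<open>ys \<in> S\<close>] \<open>xs \<noteq> ys\<close>
        unfolding strong_pow_adj_def johnson_adj_def by metis
      then have "p dvd card (xs ! i \<inter> ys ! i) choose (p - 1)"
        by (intro prime_dvd_binomial_pred p L)
      also have "\<dots> dvd (\<Prod>i<m. card (xs ! i \<inter> ys ! i) choose (p - 1))"
        using i(1) by (intro dvd_prodI) auto
      finally show ?thesis unfolding gram[OF that(1,2)] .
    qed
  qed
  also have "card D = (n choose (p - 1)) ^ m"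
    by (simp add: D_def card_PiE)
  finally show ?thesis using S(2) by simp
qed

text \<open>The sizes left out are the numbers \<open>p * j - 1\<close> with \<open>j\<close> from 1
  to \<open>p - 1\<close>.\<close>

lemma card_multiples_pred_le:
  fixes p :: nat
  shows "card ({..<p\<^sup>2 - 1} - {x. x < p\<^sup>2 - 1 \<and> \<not> p dvd Suc x}) \<le> p - 1"
proof -
  have "{..<p\<^sup>2 - 1} - {x. x < p\<^sup>2 - 1 \<and> \<not> p dvd Suc x} \<subseteq> (\<lambda>j. p * j - 1) ` {1..p - 1}"
  proof
    fix x assume "x \<in> {..<p\<^sup>2 - 1} - {x. x < p\<^sup>2 - 1 \<and> \<not> p dvd Suc x}"
    then have x: "Suc x < p * p" "p dvd Suc x" by (auto simp: power2_eq_square)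
    then obtain j where j: "Suc x = p * j" by blast
    then have "j < p" "j \<noteq> 0" "x = p * j - 1" using x(1) by (auto intro!: Nat.gr0I)
    then show "x \<in> (\<lambda>j. p * j - 1) ` {1..p - 1}" by auto
  qed
  then have "card ({..<p\<^sup>2 - 1} - {x. x < p\<^sup>2 - 1 \<and> \<not> p dvd Suc x}) \<le> card ((\<lambda>j. p * j - 1) ` {1..p - 1})"
    by (intro card_mono) auto
  also have "\<dots> \<le> p - 1" using card_image_le[of "{1..p - 1}" "\<lambda>j. p * j - 1"] by simp
  finally show ?thesis .
qed

text \<open>Raise \<open>(n / k) ^ k \<le> (n choose k)\<close> to the power \<open>e / k\<close>.
  This converts powers of the ground set size into powers of the number of vertices.\<close>

lemma power_le_binomial_powr:
  fixes n k e :: nat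
  assumes "0 < k" "k \<le> n"
  shows "real n ^ e \<le> real k ^ e * real (n choose k) powr (e / k)"
proof -
  have "0 < real n / k" using assms by simp
  have "(real n / k) ^ e = ((real n / k) ^ k) powr (e / k)"
    using assms by (simp add: powr_powr flip: powr_realpow)
  also have "\<dots> \<le> real (n choose k) powr (e / k)"
    using binomial_ge_n_over_k_pow_k[of k n, where 'a = real] assms by (intro powr_mono2) auto
  finally show ?thesis using assms by (simp add: power_divide field_simps)
qed

theorem theorem5:
  fixes \<epsilon> :: real
  assumes "\<epsilon> > 0"
  shows "\<exists>C > 0. \<forall>N :: nat. \<exists>n k :: nat. \<exists>L :: nat set.
           L \<subseteq> {..<k} \<and>
           (let V = johnson_vertices n k; E = johnson_adj L; N\<^sub>G = real (card V) in
              card V \<ge> N \<and>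
              lovasz_theta V E / real (alpha V E) \<ge> C * N\<^sub>G powr (1 - \<epsilon>) \<and>
              lovasz_theta V E / shannon_capacity V E \<ge> C * N\<^sub>G powr (1 - \<epsilon>) \<and>
              real (chi V E) / lovasz_theta V (compl_graph V E) \<ge> C * N\<^sub>G powr (1 - \<epsilon>))"
proof -
  obtain p :: nat where p: "prime p" "nat \<lceil>2 / \<epsilon>\<rceil> < p"
    using bigger_prime by blast
  have p1: "1 < p" using p(1) by (rule prime_gt_1_nat)
  define k where "k = p\<^sup>2 - 1"
  define L where "L = {x. x < k \<and> \<not> p dvd Suc x}"
  define s where "s = p - 1"
  have Suc_k: "Suc k = p * p" using p1 by (simp add: k_def power2_eq_square)
  \<comment> \<open>This factorisation makes the lost exponent \<open>2 * s / k\<close> equal to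
    \<open>2 / (p + 1)\<close>, which the choice of \<open>p\<close> keeps below
    \<open>\<epsilon>\<close>.\<close>
  have k_eq: "k = s * (p + 1)" using p1 Suc_k by (cases p) (auto simp: s_def)
  have k: "0 < k" and sk: "s \<le> k" using k_eq p1 by (auto simp: s_def)
  have exponent: "real (2 * s) / k \<le> \<epsilon>"
  proof -
    have "real k = real s * real (p + 1)" "0 < s" using k_eq p1 by (simp_all only: of_nat_mult s_def zero_less_diff)
    then have "real (2 * s) / k = 2 / (p + 1)" by simp
    also have "2 / \<epsilon> \<le> p + 1" using p(2) by linarith
    then have "2 / (p + 1) \<le> \<epsilon>" using assms by (simp add: field_simps)
    finally show ?thesis .
  qed
  obtain K where K: "0 < K" and theta: "\<And>n. k \<le> n \<Longrightarrow> 1 \<le> n \<Longrightarrow>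
      lovasz_theta (johnson_vertices n k) (compl_graph (johnson_vertices n k) (johnson_adj L))
        \<le> K * real n ^ card ({..<k} - L) \<and>
      real (n choose k) / (K * real n ^ card ({..<k} - L))
        \<le> lovasz_theta (johnson_vertices n k) (johnson_adj L)"
    using theta_johnson_bounds[of k L] by blast
  have card_s: "card ({..<k} - L) \<le> s"
    using card_multiples_pred_le[of p] by (simp add: k_def L_def s_def)
  \<comment> \<open>\<open>K\<close> comes from the bounds on the Lovasz numbers, the power of
    \<open>k\<close> from \<open>power_le_binomial_powr\<close> with exponent
    \<open>2 * s\<close>.\<close>
  define C where "C = 1 / (K * real k ^ (2 * s))"
  show ?thesis
  proof (intro exI conjI allI)
    show "0 < C" using K k by (simp add: C_def)
    fix N :: nat
    \<comment> \<open>Then \<open>n / k = N + 1\<close>, which forces at least \<open>N\<close>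
      vertices.\<close>
    define n where "n = k * Suc N"
    have n: "k \<le> n" "1 \<le> n" using k by (auto simp: n_def)
    define V where "V = johnson_vertices n k"
    define E where "E = johnson_adj L"
    define M where "M = real (card V)"
    have V: "finite V" "card V = n choose k" by (simp_all add: V_def)
    have irrefl: "\<not> E A A" for A by (simp add: E_def johnson_adj_def)
    have "real N \<le> (real n / k) ^ k"
    proof -
      have "real N \<le> real (Suc N) ^ 1" by simp
      also have "\<dots> \<le> real (Suc N) ^ k" using k by (intro power_increasing) auto
      also have "real (Suc N) = real n / k"
        using k unfolding n_def of_nat_mult by simp
      finally show ?thesis .
    qed
    also have "\<dots> \<le> M"
      using binomial_ge_n_over_k_pow_k[OF n(1), where 'a = real] by (simp add: M_def V)
    finally have cardV: "N \<le> card V" by (simp add: M_def)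
    have M1: "1 \<le> M" using n by (simp add: M_def V Suc_leI)
    then have ne: "V \<noteq> {}" by (auto simp: M_def)
    define T where "T = real n ^ s"
    have T: "1 \<le> T" using n by (simp add: T_def)
    have pow: "alpha (strong_pow_vertices V m) (strong_pow_adj E) \<le> (n choose s) ^ m" for m
      unfolding V_def E_def s_def
      by (rule alpha_strong_pow_johnson_le) (use p(1) Suc_k in \<open>auto simp: L_def\<close>)
    have choose_T: "real (n choose s) \<le> T"
      using binomial_le_pow[of s n] sk n unfolding T_def by (metis le_trans of_nat_le_iff of_nat_power)
    have alpha: "1 \<le> real (alpha V E)" "real (alpha V E) \<le> T"
    proof -
      show "1 \<le> real (alpha V E)" using alpha_ge_1[where E = E, OF V(1)] ne irrefl by force
      have "alpha V E \<le> n choose s"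
        using alpha_le_strong_pow_1[where E = E, OF V(1) irrefl] pow[of 1] by simp
      then show "real (alpha V E) \<le> T" using choose_T by linarith
    qed
    have cap: "1 \<le> shannon_capacity V E" "shannon_capacity V E \<le> T"
      using shannon_capacity_bounds[OF V(1) ne pow] choose_T by auto
    have nT: "real n ^ card ({..<k} - L) \<le> T" "0 < real n ^ card ({..<k} - L)"
      using n card_s unfolding T_def by (auto intro: power_increasing)
    have theta_c: "1 \<le> lovasz_theta V (compl_graph V E)" "lovasz_theta V (compl_graph V E) \<le> K * T"
    proof -
      show "1 \<le> lovasz_theta V (compl_graph V E)"
        using ne theta_ge_1[OF V(1)] by (force simp: compl_graph_def)
      have "lovasz_theta V (compl_graph V E) \<le> K * real n ^ card ({..<k} - L)"
        using theta[OF n] by (simp add: V_def E_def)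
      also have "\<dots> \<le> K * T" using nT K by simp
      finally show "lovasz_theta V (compl_graph V E) \<le> K * T" .
    qed
    have theta_V: "M / (K * T) \<le> lovasz_theta V E"
    proof -
      have "M / (K * T) \<le> M / (K * real n ^ card ({..<k} - L))"
        using nT K M1 T by (intro divide_left_mono mult_left_mono mult_pos_pos) auto
      also have "\<dots> \<le> lovasz_theta V E"
        using theta[OF n] unfolding M_def V(2) by (simp add: V_def E_def)
      finally show ?thesis .
    qed
    \<comment> \<open>Each of the three ratios loses one factor \<open>T\<close> in the numerator
      and one in the denominator.\<close>
    have main: "C * M powr (1 - \<epsilon>) \<le> M / (K * T * T)"
    proof -
      have "T * T = real n ^ (2 * s)" by (simp add: T_def mult_2 power_add)
      also have "\<dots> \<le> real k ^ (2 * s) * M powr (real (2 * s) / k)"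
        using power_le_binomial_powr[OF k n(1), of "2 * s"] by (simp add: M_def V)
      also have "\<dots> \<le> real k ^ (2 * s) * M powr \<epsilon>"
        using exponent M1 by (intro mult_left_mono powr_mono) auto
      finally have "K * (T * T) \<le> K * (real k ^ (2 * s) * M powr \<epsilon>)" using K by simp
      then have "M / (K * (real k ^ (2 * s) * M powr \<epsilon>)) \<le> M / (K * (T * T))"
        using K M1 T k by (intro divide_left_mono mult_pos_pos) auto
      then show ?thesis using M1 by (simp add: C_def powr_diff mult.assoc)
    qed
    have ratio: "C * M powr (1 - \<epsilon>) \<le> x / y" if "M / (K * T) \<le> x" "1 \<le> y" "y \<le> T" for x y
    proof -
      have "M / (K * T * T) = M / (K * T) / T" by simp
      also have "\<dots> \<le> x / y"
      proof (rule frac_le)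
        have "0 \<le> M / (K * T)" using K M1 T by simp
        then show "0 \<le> x" using that(1) by linarith
      qed (use that in auto)
      finally show ?thesis using main by linarith
    qed
    have chi: "C * M powr (1 - \<epsilon>) \<le> real (chi V E) / lovasz_theta V (compl_graph V E)"
    proof -
      have "M \<le> real (chi V E) * real (alpha V E)"
        using card_le_chi_mult_alpha[where E = E, OF V(1) irrefl] unfolding M_def by (metis of_nat_le_iff of_nat_mult)
      also have "\<dots> \<le> real (chi V E) * T" using alpha by (intro mult_left_mono) auto
      finally have "M / T \<le> real (chi V E)" using T by (simp add: field_simps)
      then have "M / T / (K * T) \<le> real (chi V E) / lovasz_theta V (compl_graph V E)"
        using theta_c M1 T by (intro frac_le) auto
      then show ?thesis using main by (simp add: mult_ac)
    qed
    show "L \<subseteq> {..<k}" by (auto simp: L_def)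
    show "let V = johnson_vertices n k; E = johnson_adj L; N\<^sub>G = real (card V) in
              card V \<ge> N \<and>
              lovasz_theta V E / real (alpha V E) \<ge> C * N\<^sub>G powr (1 - \<epsilon>) \<and>
              lovasz_theta V E / shannon_capacity V E \<ge> C * N\<^sub>G powr (1 - \<epsilon>) \<and>
              real (chi V E) / lovasz_theta V (compl_graph V E) \<ge> C * N\<^sub>G powr (1 - \<epsilon>)"
      unfolding Let_def V_def[symmetric] E_def[symmetric] M_def[symmetric]
      using cardV ratio[OF theta_V alpha] ratio[OF theta_V cap] chi by blast
  qed
qed

end
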